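(* Fix an equivariant map $r:\mathcal X_*\to G$ (that is, $r(gx)=g\,r(x)$ for all $g\in G$, $x\in\mathcal X_*$) and a map $s:\mathcal Z\to G$. Let $x$ be distributed on $\mathcal X_*$ according to $p(x\mid [h],[g];f)\,\lambda(dx)$. Then the distribution of the statistic $z=z(x)=\{r(x)\}^{-1}x$ is null robust in the sense that when $[h]=[e_H]=H_0$, where $e_H$ is the identity element of $H$, the distribution of $z$ does not depend on $f$. Specifically, when $[h]=[e_H]$, the distribution of $z$ has density $p_{\mathcal Z}(z\mid [e_H],[g];f)$ with respect to $\nu_{\mathcal Z}$ given by $$p_{\mathcal Z}(z\mid [e_H],[g];f)=p_{\mathcal Z}(z):=\frac{c}{\chi_G(s(z))\,\Delta_G(s(z))},$$ where $\Delta_G$ is the right-hand modulus of $G$ (i.e. $\mu_G(d(gg'))=\Delta_G(g')\,\mu_G(dg)$ for $g'\in G$) and $$c=\int_G f(r)\chi_G(r)\,\mu_G(dr)=\frac{1}{\int_{\mathcal Z}\{\chi_G(s(z))\Delta_G(s(z))\}^{-1}\,\nu_{\mathcal Z}(dz)}.$$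
   Context: Spaces and groups. A group $H$ acts on a space $\mathcal X$ to the left, $(h,x)\mapsto hx$, and another group $G$ acts on a subspace $\mathcal X_*\subseteq\mathcal X$ to the left, $(g,x)\mapsto gx$. $\mathcal X$ and $\mathcal X_*$ are locally compact Hausdorff spaces; $H$ and $G$ are second countable, locally compact Hausdorff topological groups; both actions are continuous. Orbital decomposition. $r:\mathcal X_*\to G$ satisfies $r(gx)=g\,r(x)$ for $g\in G$, $x\in\mathcal X_*$. Put $z(x):=\{r(x)\}^{-1}x$ for $x\in\mathcal X_*$ and $\mathcal Z:=\{z(x):x\in\mathcal X_*\}$. Then every $x\in\mathcal X_*$ is uniquely written $x=gz$ with $g\in G$, $z\in\mathcal Z$ (namely $g=r(x)$, $z=z(x)$), so $\mathcal X_*$ is in one-to-one correspondence with $G\times\mathcal Z$. Dominating measure. $\lambda$ is a measure on $\mathcal X$, relatively invariant under $H$ with multiplier $\chi_H$: $\lambda(d(hx))=\chi_H(h)\lambda(dx)$, $h\in H$. Its restriction to $\mathcal X_*$ is relatively invariant under $G$ with multiplier $\chi_G$: $\lambda(d(gx))=\chi_G(g)\lambda(dx)$, $g\in G$. (Multipliers are continuous homomorphisms into the multiplicative group of positive reals.) It is assumed that $\lambda(\mathcal X\setminus h\mathcal X_* )=0$ for each $h\in H$, where $h\mathcal X_*=\{hx:x\in\mathcal X_*\}$; hence expressions involving $r(h^{-1}x)$ or $z(h^{-1}x)$ are defined for $\lambda$-almost every $x$. $\mu_G$ is a left invariant measure on $G$ (unique up to a multiplicative constant). It is assumed that there is a measure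 $\nu_{\mathcal Z}$ on $\mathcal Z$ such that $\lambda=\chi_G\mu_G\otimes\nu_{\mathcal Z}$ under the correspondence $\mathcal X_*\ni x\leftrightarrow (r(x),z(x))\in G\times\mathcal Z$; the measure $\nu_{\mathcal Z}$ does not depend on $f$. Sampling model. Given $s:\mathcal Z\to G$ and $f:G\to\mathbb R_{\ge 0}$ with $\int_{\mathcal X_*} f(r(x)s(z(x)))\,\lambda(dx)=1$, for $h\in H$, $g\in G$ define the density with respect to $\lambda$ on $\mathcal X_*$ $$p(x\mid h,g;f)=\frac{1}{\chi_H(h)\chi_G(g)}\,f\big(g^{-1}r(h^{-1}x)\,s(z(h^{-1}x))\big).$$ It is assumed that there are compact subgroups $H_0\subseteq H$ and $G_0\subseteq G$ such that $f(g_0g)=f(g)$ for all $g\in G$, $g_0\in G_0$, and $r(h_0x)=r(x)$, $s(z(h_0x))=s(z(x))$ for all $x\in\mathcal X_*$, $h_0\in H_0$ (up to $\lambda$-null sets where $h_0x\notin\mathcal X_*$). Write $[h]=hH_0$, $[g]=gG_0$ for left cosets; then $p(\cdot\mid h,g;f)$ depends on $(h,g)$ only through $([h],[g])$ and is also written $p(\cdot\mid[h],[g];f)$. Only those $f$ are considered for which $p(\cdot\mid[h],[g];f)$ and $p(\cdot\mid[h'],[g'];f)$ give the same distribution if and only if $([h],[g])=([h'],[g'])$. "Does not depend on $f$" means: is the same for all such $f$, with the remaining data (spaces, groups, actions, $\lambda$, $r$, $s$, $H_0$, $G_0$) fixed. All maps are measurable (the correspondence $\mathcal X_*\leftrightarrow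 G\times\mathcal Z$ in both directions) and all measures are $\sigma$-finite. *)

theory Defs
  imports "HOL-Analysis.Analysis" "HOL-Algebra.Group_Action"
begin

(* Topological groups are HOL-Algebra groups whose carrier is a whole topological type, so that
   left and right translates of a set B are g <# B and B #> g. *)

locale lcsc_group = group G
  for G :: "'g :: {t2_space, second_countable_topology} monoid" (structure) +
  assumes carrier_UNIV: "carrier G = UNIV"
    and continuous_mult: "continuous_on UNIV (\<lambda>(g, g'). g \<otimes> g')"
    and continuous_inv: "continuous_on UNIV (\<lambda>g. inv g)"
    and locally_compact: "locally_compact_space (euclidean :: 'g topology)"

definition continuous_action ::
    "'g :: topological_space monoid \<Rightarrow> 'x :: topological_space set \<Rightarrow> ('g \<Rightarrow> 'x \<Rightarrow> 'x) \<Rightarrow> bool" where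
  "continuous_action G E act \<longleftrightarrow>
     group_action G E act \<and> continuous_on (carrier G \<times> E) (\<lambda>(g, x). act g x)"

definition multiplier :: "'g :: topological_space monoid \<Rightarrow> ('g \<Rightarrow> real) \<Rightarrow> bool" where
  "multiplier G chi \<longleftrightarrow> continuous_on (carrier G) chi \<and> (\<forall>g \<in> carrier G. 0 < chi g) \<and>
     (\<forall>g \<in> carrier G. \<forall>g' \<in> carrier G. chi (g \<otimes>\<^bsub>G\<^esub> g') = chi g * chi g')"

definition relatively_invariant ::
    "'g :: topological_space monoid \<Rightarrow> ('g \<Rightarrow> 'x \<Rightarrow> 'x) \<Rightarrow> 'x measure \<Rightarrow> ('g \<Rightarrow> real) \<Rightarrow> bool" where
  "relatively_invariant G act M chi \<longleftrightarrow> multiplier G chi \<and>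
     (\<forall>g \<in> carrier G. \<forall>B \<in> sets M. emeasure M (act g ` B) = ennreal (chi g) * emeasure M B)"

definition left_Haar_measure :: "'g :: topological_space monoid \<Rightarrow> 'g measure \<Rightarrow> bool" where
  "left_Haar_measure G \<mu> \<longleftrightarrow> sets \<mu> = sets borel \<and> sigma_finite_measure \<mu> \<and>
     emeasure \<mu> (space \<mu>) \<noteq> 0 \<and>
     (\<forall>g \<in> carrier G. \<forall>B \<in> sets \<mu>. emeasure \<mu> (g <#\<^bsub>G\<^esub> B) = emeasure \<mu> B)"

(* The defining property of the modulus function, which determines it on G since the measure
   is nonzero and sigma-finite; it exists by uniqueness of left Haar measure. *)

definition right_modulus :: "'g monoid \<Rightarrow> 'g measure \<Rightarrow> ('g \<Rightarrow> real) \<Rightarrow> bool" where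
  "right_modulus G \<mu> \<Delta> \<longleftrightarrow> (\<forall>g \<in> carrier G. 0 < \<Delta> g \<and>
     (\<forall>B \<in> sets \<mu>. emeasure \<mu> (B #>\<^bsub>G\<^esub> g) = ennreal (\<Delta> g) * emeasure \<mu> B))"

definition zmap :: "'g monoid \<Rightarrow> ('g \<Rightarrow> 'x \<Rightarrow> 'x) \<Rightarrow> ('x \<Rightarrow> 'g) \<Rightarrow> 'x \<Rightarrow> 'x" where
  "zmap G actG r x = actG (inv\<^bsub>G\<^esub> (r x)) x"

text \<open>
  \<open>\<Z>\<close> carries the trace of the Borel algebra: it is the only choice that makes the
  correspondence between \<open>Xs\<close> and \<open>G \<times> \<Z>\<close> measurable in both directions, because \<open>zmap\<close>
  fixes every point of \<open>\<Z>\<close>. With \<open>h = \<one>\<close>, \<open>null_complement\<close> says that \<open>Xs\<close> is a Borel set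
  (as a locally compact subspace of a Hausdorff space always is) with null complement.
  The exceptional null sets in the invariance under \<open>H0\<close> are those where \<open>h x \<notin> Xs\<close>.
\<close>

locale orbital_model =
  H: lcsc_group H + G: lcsc_group G
  for H :: "'h :: {t2_space, second_countable_topology} monoid"
    and G :: "'g :: {t2_space, second_countable_topology} monoid" +
  fixes Xs \<Z> :: "'x :: t2_space set"
    and actH :: "'h \<Rightarrow> 'x \<Rightarrow> 'x" and actG :: "'g \<Rightarrow> 'x \<Rightarrow> 'x"
    and H0 :: "'h set" and G0 :: "'g set"
    and lam :: "'x measure" and \<mu> :: "'g measure" and \<nu> :: "'x measure"
    and chiH :: "'h \<Rightarrow> real" and chiG :: "'g \<Rightarrow> real"
    and r :: "'x \<Rightarrow> 'g" and s :: "'x \<Rightarrow> 'g"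
  assumes locally_compact_X: "locally_compact_space (euclidean :: 'x topology)"
    and locally_compact_Xs: "locally_compact_space (top_of_set Xs)"
    and action_H: "continuous_action H UNIV actH"
    and action_G: "continuous_action G Xs actG"
    and sets_lam: "sets lam = sets borel"
    and sigma_finite_lam: "sigma_finite_measure lam"
    and invariant_H: "relatively_invariant H actH lam chiH"
    and invariant_G: "relatively_invariant G actG (restrict_space lam Xs) chiG"
    and null_complement: "\<And>h. UNIV - actH h ` Xs \<in> null_sets lam"
    and haar: "left_Haar_measure G \<mu>"
    and equivariant_r: "\<And>g x. x \<in> Xs \<Longrightarrow> r (actG g x) = g \<otimes>\<^bsub>G\<^esub> r x"
    and \<Z>_def: "\<Z> = zmap G actG r ` Xs"
    and measurable_decomposition: "(\<lambda>x. (r x, zmap G actG r x))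
      \<in> restrict_space borel Xs \<rightarrow>\<^sub>M borel \<Otimes>\<^sub>M restrict_space borel \<Z>"
    and measurable_composition: "(\<lambda>(g, z). actG g z)
      \<in> borel \<Otimes>\<^sub>M restrict_space borel \<Z> \<rightarrow>\<^sub>M restrict_space borel Xs"
    and measurable_s: "s \<in> restrict_space borel \<Z> \<rightarrow>\<^sub>M borel"
    and sets_\<nu>: "sets \<nu> = sets (restrict_space borel \<Z>)"
    and sigma_finite_\<nu>: "sigma_finite_measure \<nu>"
    and factorization: "distr (restrict_space lam Xs) (borel \<Otimes>\<^sub>M restrict_space borel \<Z>)
      (\<lambda>x. (r x, zmap G actG r x)) = density \<mu> (\<lambda>g. ennreal (chiG g)) \<Otimes>\<^sub>M \<nu>"
    and subgroup_H0: "subgroup H0 H" and compact_H0: "compact H0"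
    and subgroup_G0: "subgroup G0 G" and compact_G0: "compact G0"
    and H0_invariant_r: "\<And>h x. \<lbrakk>h \<in> H0; x \<in> Xs; actH h x \<in> Xs\<rbrakk> \<Longrightarrow> r (actH h x) = r x"
    and H0_invariant_s: "\<And>h x. \<lbrakk>h \<in> H0; x \<in> Xs; actH h x \<in> Xs\<rbrakk> \<Longrightarrow>
      s (zmap G actG r (actH h x)) = s (zmap G actG r x)"

text \<open>
  The density \<open>p(x | h, g; f)\<close> with respect to \<open>lam\<close> on \<open>Xs\<close>. It is set to 0 on the null set
  of those \<open>x\<close> with \<open>h\<inverse> x \<notin> Xs\<close>, where \<open>r (h\<inverse> x)\<close> has no meaning.
\<close>

definition sampling_density ::
    "'h monoid \<Rightarrow> 'g monoid \<Rightarrow> 'x set \<Rightarrow> ('h \<Rightarrow> 'x \<Rightarrow> 'x) \<Rightarrow> ('g \<Rightarrow> 'x \<Rightarrow> 'x) \<Rightarrow> ('h \<Rightarrow> real) \<Rightarrow>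
     ('g \<Rightarrow> real) \<Rightarrow> ('x \<Rightarrow> 'g) \<Rightarrow> ('x \<Rightarrow> 'g) \<Rightarrow> 'h \<Rightarrow> 'g \<Rightarrow> ('g \<Rightarrow> real) \<Rightarrow> 'x \<Rightarrow> real" where
  "sampling_density H G Xs actH actG chiH chiG r s h g f x =
     (let y = actH (inv\<^bsub>H\<^esub> h) x in
      if y \<in> Xs
      then 1 / (chiH h * chiG g) * f (inv\<^bsub>G\<^esub> g \<otimes>\<^bsub>G\<^esub> r y \<otimes>\<^bsub>G\<^esub> s (zmap G actG r y))
      else (0 :: real))"

definition sampling_distr ::
    "'h monoid \<Rightarrow> 'g monoid \<Rightarrow> 'x set \<Rightarrow> ('h \<Rightarrow> 'x \<Rightarrow> 'x) \<Rightarrow> ('g \<Rightarrow> 'x \<Rightarrow> 'x) \<Rightarrow> 'x measure \<Rightarrow>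
     ('h \<Rightarrow> real) \<Rightarrow> ('g \<Rightarrow> real) \<Rightarrow> ('x \<Rightarrow> 'g) \<Rightarrow> ('x \<Rightarrow> 'g) \<Rightarrow>
     'h \<Rightarrow> 'g \<Rightarrow> ('g \<Rightarrow> real) \<Rightarrow> 'x measure" where
  "sampling_distr H G Xs actH actG lam chiH chiG r s h g f =
     density (restrict_space lam Xs)
       (\<lambda>x. ennreal (sampling_density H G Xs actH actG chiH chiG r s h g f x))"

definition admissible ::
    "'h monoid \<Rightarrow> 'g :: topological_space monoid \<Rightarrow> 'x set \<Rightarrow> ('h \<Rightarrow> 'x \<Rightarrow> 'x) \<Rightarrow> ('g \<Rightarrow> 'x \<Rightarrow> 'x) \<Rightarrow>
     'h set \<Rightarrow> 'g set \<Rightarrow> 'x measure \<Rightarrow> ('h \<Rightarrow> real) \<Rightarrow> ('g \<Rightarrow> real) \<Rightarrow> ('x \<Rightarrow> 'g) \<Rightarrow> ('x \<Rightarrow> 'g) \<Rightarrow>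
     ('g \<Rightarrow> real) \<Rightarrow> bool" where
  "admissible H G Xs actH actG H0 G0 lam chiH chiG r s f \<longleftrightarrow>
     f \<in> borel_measurable borel \<and> (\<forall>g. 0 \<le> f g) \<and>
     (\<integral>\<^sup>+ x. ennreal (f (r x \<otimes>\<^bsub>G\<^esub> s (zmap G actG r x))) \<partial>restrict_space lam Xs) = 1 \<and>
     (\<forall>g0 \<in> G0. \<forall>g. f (g0 \<otimes>\<^bsub>G\<^esub> g) = f g) \<and>
     (\<forall>h g h' g'.
        sampling_distr H G Xs actH actG lam chiH chiG r s h g f =
        sampling_distr H G Xs actH actG lam chiH chiG r s h' g' f \<longleftrightarrow>
        h <#\<^bsub>H\<^esub> H0 = h' <#\<^bsub>H\<^esub> H0 \<and> g <#\<^bsub>G\<^esub> G0 = g' <#\<^bsub>G\<^esub> G0)"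

definition z_distr ::
    "'h monoid \<Rightarrow> 'g monoid \<Rightarrow> 'x :: topological_space set \<Rightarrow> 'x set \<Rightarrow> ('h \<Rightarrow> 'x \<Rightarrow> 'x) \<Rightarrow>
     ('g \<Rightarrow> 'x \<Rightarrow> 'x) \<Rightarrow> 'x measure \<Rightarrow> ('h \<Rightarrow> real) \<Rightarrow> ('g \<Rightarrow> real) \<Rightarrow> ('x \<Rightarrow> 'g) \<Rightarrow> ('x \<Rightarrow> 'g) \<Rightarrow>
     'h \<Rightarrow> 'g \<Rightarrow> ('g \<Rightarrow> real) \<Rightarrow> 'x measure" where
  "z_distr H G Xs \<Z> actH actG lam chiH chiG r s h g f =
     distr (sampling_distr H G Xs actH actG lam chiH chiG r s h g f)
       (restrict_space borel \<Z>) (zmap G actG r)"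

end

theory Submission
  imports Defs
begin

text \<open>
  Admissibility already identifies the distributions belonging to \<open>(h, g)\<close> and \<open>(\<one>, g)\<close>
  when \<open>h H0 = H0\<close>, so only \<open>h = \<one>\<close> needs to be treated. There the factorization of \<open>lam\<close>
  turns integrals against the sampling density into iterated integrals over \<open>G \<times> \<Z>\<close>. In the
  inner integral \<open>\<integral> f (g\<inverse> r s(z)) \<chi>(r) \<mu>(dr)\<close>, left invariance removes \<open>g\<close> and right
  translation by \<open>s(z)\<close> splits off the factor \<open>1 / (\<chi>(s(z)) \<Delta>(s(z)))\<close>; what remains is
  \<open>\<integral> f \<chi> d\<mu>\<close>, whose value the normalization of \<open>f\<close> forces.
\<close>

section \<open>Translates and the modulus of a left Haar measure\<close>

context lcsc_group
begin

text \<open>By second countability the Borel algebra of \<open>G \<times> G\<close> is the product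
  of the Borel algebras (\<open>borel_prod\<close>), so joint continuity of the multiplication gives
  measurability for the product algebra.\<close>

lemma measurable_mult [measurable (raw)]:
  assumes "a \<in> M \<rightarrow>\<^sub>M borel" "b \<in> M \<rightarrow>\<^sub>M borel"
  shows "(\<lambda>x. a x \<otimes> b x) \<in> M \<rightarrow>\<^sub>M borel"
proof -
  have "(\<lambda>(g, g'). g \<otimes> g') \<in> borel_measurable (borel \<Otimes>\<^sub>M borel)"
    unfolding borel_prod by (rule borel_measurable_continuous_onI) (rule continuous_mult)
  from measurable_compose[OF measurable_Pair[OF assms] this] show ?thesis by simp
qed

text \<open>Pushforward measures are computed from preimages, while invariance and modulus are
  stated for translated sets. This lemma and the next pass from one to the other.\<close>

lemma left_vimage_eq: "(\<lambda>x. g \<otimes> x) -` B = inv g <# B"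
proof -
  have "x = inv g \<otimes> (g \<otimes> x)" "g \<otimes> (inv g \<otimes> x) = x" for x
    using carrier_UNIV by (simp_all add: m_assoc[symmetric])
  then show ?thesis unfolding l_coset_def by force
qed

lemma right_vimage_eq: "(\<lambda>x. x \<otimes> g) -` B = B #> inv g"
proof -
  have "x = (x \<otimes> g) \<otimes> inv g" "(x \<otimes> inv g) \<otimes> g = x" for x
    using carrier_UNIV by (simp_all add: m_assoc)
  then show ?thesis unfolding r_coset_def by force
qed

lemma right_coset_measurable:
  assumes "B \<in> sets borel"
  shows "B #> g \<in> sets borel"
proof -
  have "(\<lambda>x. x \<otimes> inv g) -` B \<inter> space borel \<in> sets borel"
    using assms by (intro measurable_sets[where A = borel]) auto
  then show ?thesis using carrier_UNIV by (simp add: right_vimage_eq)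
qed

text \<open>Left invariance says that \<open>\<mu>\<close> equals its own pushforward under
  \<open>x \<mapsto> g x\<close>; the claim is then a change of variables.\<close>

lemma nn_integral_left_translate:
  assumes haar: "left_Haar_measure G \<mu>" and [measurable]: "F \<in> borel_measurable borel"
  shows "(\<integral>\<^sup>+ x. F (g \<otimes> x) \<partial>\<mu>) = (\<integral>\<^sup>+ x. F x \<partial>\<mu>)"
proof -
  have sets [measurable_cong]: "sets \<mu> = sets borel"
    using haar by (simp add: left_Haar_measure_def)
  have "distr \<mu> borel (\<lambda>x. g \<otimes> x) = \<mu>"
  proof (rule measure_eqI)
    fix B assume "B \<in> sets (distr \<mu> borel (\<lambda>x. g \<otimes> x))"
    then have B: "B \<in> sets borel" by simp
    have "emeasure (distr \<mu> borel (\<lambda>x. g \<otimes> x)) B = emeasure \<mu> (inv g <# B)"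
      using B sets_eq_imp_space_eq[OF sets] by (subst emeasure_distr) (auto simp: left_vimage_eq)
    then show "emeasure (distr \<mu> borel (\<lambda>x. g \<otimes> x)) B = emeasure \<mu> B"
      using haar B sets carrier_UNIV by (simp add: left_Haar_measure_def)
  qed (simp add: sets)
  moreover have "(\<integral>\<^sup>+ x. F x \<partial>distr \<mu> borel (\<lambda>x. g \<otimes> x)) = (\<integral>\<^sup>+ x. F (g \<otimes> x) \<partial>\<mu>)"
    by (rule nn_integral_distr) auto
  ultimately show ?thesis by simp
qed

text \<open>The pushforward of \<open>\<mu>\<close> under \<open>x \<mapsto> x g\<close> gives
  \<open>B\<close> the mass of \<open>B #> inv g\<close>. This is why the modulus enters
  inverted.\<close>

lemma nn_integral_right_translate:
  assumes haar: "left_Haar_measure G \<mu>" and modulus: "right_modulus G \<mu> \<Delta>"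
    and [measurable]: "F \<in> borel_measurable borel"
  shows "(\<integral>\<^sup>+ x. F (x \<otimes> g) \<partial>\<mu>) = ennreal (inverse (\<Delta> g)) * (\<integral>\<^sup>+ x. F x \<partial>\<mu>)"
proof -
  have sets [measurable_cong]: "sets \<mu> = sets borel"
    using haar by (simp add: left_Haar_measure_def)
  have pos: "0 < \<Delta> g"
    using modulus carrier_UNIV by (simp add: right_modulus_def)
  have "distr \<mu> borel (\<lambda>x. x \<otimes> g) = scale_measure (ennreal (inverse (\<Delta> g))) \<mu>"
  proof (rule measure_eqI)
    fix B assume "B \<in> sets (distr \<mu> borel (\<lambda>x. x \<otimes> g))"
    then have B: "B \<in> sets borel" by simp
    \<comment> \<open>The modulus property is applied to \<open>B #> inv g\<close>, which translates
      back to \<open>B\<close>, so that the factor is \<open>\<Delta> g\<close> rather than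
      \<open>\<Delta> (inv g)\<close>.\<close>
    have "emeasure \<mu> ((B #> inv g) #> g) = ennreal (\<Delta> g) * emeasure \<mu> (B #> inv g)"
      using modulus right_coset_measurable[OF B] sets carrier_UNIV
      by (simp add: right_modulus_def)
    moreover have "(B #> inv g) #> g = B"
      using carrier_UNIV by (simp add: coset_mult_assoc)
    moreover have "ennreal (inverse (\<Delta> g)) * ennreal (\<Delta> g) = 1"
      using pos by (simp add: ennreal_mult[symmetric])
    ultimately have "emeasure \<mu> (B #> inv g) = ennreal (inverse (\<Delta> g)) * emeasure \<mu> B"
      by (simp add: mult.assoc[symmetric])
    then show "emeasure (distr \<mu> borel (\<lambda>x. x \<otimes> g)) B
        = emeasure (scale_measure (ennreal (inverse (\<Delta> g))) \<mu>) B"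
      using B sets_eq_imp_space_eq[OF sets] by (subst emeasure_distr) (auto simp: right_vimage_eq)
  qed (simp add: sets)
  moreover have "(\<integral>\<^sup>+ x. F x \<partial>distr \<mu> borel (\<lambda>x. x \<otimes> g)) = (\<integral>\<^sup>+ x. F (x \<otimes> g) \<partial>\<mu>)"
    by (rule nn_integral_distr) auto
  ultimately show ?thesis by (simp add: nn_integral_scale_measure)
qed

text \<open>
  For a set \<open>B\<close> with \<open>0 < \<mu> B < \<infinity>\<close>, the function \<open>g \<mapsto> \<mu> (B g\<inverse>) = \<mu> B / \<Delta> g\<close> is
  measurable by Fubini's theorem.
\<close>

lemma right_modulus_measurable:
  assumes haar: "left_Haar_measure G \<mu>" and modulus: "right_modulus G \<mu> \<Delta>"
  shows "\<Delta> \<in> borel_measurable borel"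
proof -
  interpret sigma_finite_measure \<mu>
    using haar by (simp add: left_Haar_measure_def)
  have sets [measurable_cong]: "sets \<mu> = sets borel"
    using haar by (simp add: left_Haar_measure_def)
  have pos: "0 < \<Delta> g" for g
    using modulus carrier_UNIV by (simp add: right_modulus_def)
  obtain B where B: "B \<in> sets \<mu>" "emeasure \<mu> B \<noteq> 0" "emeasure \<mu> B \<noteq> \<infinity>"
  proof -
    obtain A :: "nat \<Rightarrow> 'g set" where A: "range A \<subseteq> sets \<mu>" "(\<Union>i. A i) = space \<mu>"
        "\<And>i. emeasure \<mu> (A i) \<noteq> \<infinity>"
      using sigma_finite by blast
    \<comment> \<open>Otherwise the whole space would be a countable union of null sets, but a Haar
      measure is nonzero.\<close>
    have "\<exists>i. emeasure \<mu> (A i) \<noteq> 0"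
    proof (rule ccontr)
      assume "\<not> (\<exists>i. emeasure \<mu> (A i) \<noteq> 0)"
      then have "emeasure \<mu> (\<Union>i. A i) = 0"
        using A by (intro emeasure_UN_eq_0) auto
      then show False using haar A by (simp add: left_Haar_measure_def)
    qed
    with A that show thesis by blast
  qed
  have [measurable]: "B \<in> sets borel" using B sets by simp
  define b where "b = measure \<mu> B"
  have b: "emeasure \<mu> B = ennreal b" "0 < b"
    using B by (auto simp: b_def emeasure_eq_ennreal_measure zero_less_measure_iff)
  define T where "T g = (\<integral>\<^sup>+ x. indicator B (x \<otimes> g) \<partial>\<mu>)" for g
  have T: "T g = ennreal (inverse (\<Delta> g) * b)" for g
    unfolding T_def using nn_integral_right_translate[OF haar modulus, of "indicator B" g] pos[of g] b B
    by (simp add: ennreal_mult)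
  have [measurable]: "T \<in> borel_measurable borel"
    unfolding T_def by measurable
  \<comment> \<open>\<open>T g\<close> is \<open>b / \<Delta> g\<close> with \<open>b > 0\<close>,
    hence finite and positive: \<open>enn2real\<close> loses nothing and the equation can be solved
    for \<open>\<Delta> g\<close>.\<close>
  have "\<Delta> = (\<lambda>g. b / enn2real (T g))"
    using pos b by (auto simp: T enn2real_ennreal less_imp_le field_simps)
  moreover have "(\<lambda>g. b / enn2real (T g)) \<in> borel_measurable borel"
    by measurable
  ultimately show ?thesis by simp
qed

end

section \<open>Multipliers at the identity and products equal to 1\<close>

lemma multiplier_one:
  assumes "group G" "multiplier G chi"
  shows "chi \<one>\<^bsub>G\<^esub> = 1"
proof -
  interpret group G by fact
  have "chi \<one>\<^bsub>G\<^esub> * chi \<one>\<^bsub>G\<^esub> = chi \<one>\<^bsub>G\<^esub>" "0 < chi \<one>\<^bsub>G\<^esub>"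
    using assms(2) unfolding multiplier_def by (metis l_one one_closed)+
  then show ?thesis by simp
qed

text \<open>A product with a factor 0 is 0, and one with a factor \<open>\<infinity>\<close> is 0 or
  \<open>\<infinity>\<close>. Applied to the normalization identity, this yields convergence and
  positivity of both of its integrals.\<close>

lemma ennreal_mult_eq_1D:
  assumes "a * b = (1 :: ennreal)"
  shows "0 < a" "a < \<infinity>"
proof -
  show "0 < a" using assms by (auto simp: zero_less_iff_neq_zero)
  have "a \<noteq> \<infinity>" using assms by (auto simp: ennreal_top_mult split: if_splits)
  then show "a < \<infinity>" by (simp add: less_top)
qed

section \<open>Measurability of the orbital decomposition and integration along it\<close>

context orbital_model
begin

abbreviation "z \<equiv> zmap G actG r"

lemma multiplier_chiH: "multiplier H chiH"
  using invariant_H by (simp add: relatively_invariant_def)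

lemma multiplier_chiG: "multiplier G chiG"
  using invariant_G by (simp add: relatively_invariant_def)

lemma chiG_pos: "0 < chiG g"
  using multiplier_chiG G.carrier_UNIV by (simp add: multiplier_def)

lemma chiG_mult: "chiG (g \<otimes>\<^bsub>G\<^esub> g') = chiG g * chiG g'"
  using multiplier_chiG G.carrier_UNIV by (simp add: multiplier_def)

lemma chiG_measurable [measurable]: "chiG \<in> borel_measurable borel"
  using multiplier_chiG G.carrier_UNIV
  by (intro borel_measurable_continuous_onI) (simp add: multiplier_def)

lemma sets_\<mu> [measurable_cong]: "sets \<mu> = sets borel"
  using haar by (simp add: left_Haar_measure_def)

lemma s_measurable [measurable]: "s \<in> \<nu> \<rightarrow>\<^sub>M borel"
  using measurable_s measurable_cong_sets[OF sets_\<nu> refl] by blast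

lemma actH_one: "actH \<one>\<^bsub>H\<^esub> x = x"
proof -
  interpret group_action H UNIV actH
    using action_H by (simp add: continuous_action_def)
  show ?thesis using id_eq_one by (metis UNIV_I restrict_apply)
qed

lemma space_restrict_lam: "space (restrict_space lam Xs) = Xs"
  using sets_eq_imp_space_eq[OF sets_lam] by (simp add: space_restrict_space)

lemma sets_restrict_lam: "sets (restrict_space lam Xs) = sets (restrict_space borel Xs)"
  using sets_lam by (simp add: sets_restrict_space)

lemma decomposition_measurable:
  "(\<lambda>x. (r x, z x)) \<in> restrict_space lam Xs \<rightarrow>\<^sub>M borel \<Otimes>\<^sub>M restrict_space borel \<Z>"
  using measurable_decomposition measurable_cong_sets[OF sets_restrict_lam refl] by blast

lemma z_measurable [measurable]: "z \<in> restrict_space lam Xs \<rightarrow>\<^sub>M restrict_space borel \<Z>"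
  using measurable_compose[OF decomposition_measurable measurable_snd] by simp

lemma r_measurable [measurable]: "r \<in> restrict_space lam Xs \<rightarrow>\<^sub>M borel"
  using measurable_compose[OF decomposition_measurable measurable_fst] by simp

lemma nn_integral_factorization:
  assumes [measurable]: "\<Phi> \<in> borel_measurable (borel \<Otimes>\<^sub>M \<nu>)"
  shows "(\<integral>\<^sup>+ x. \<Phi> (r x, z x) \<partial>restrict_space lam Xs)
    = (\<integral>\<^sup>+ y. (\<integral>\<^sup>+ g. ennreal (chiG g) * \<Phi> (g, y) \<partial>\<mu>) \<partial>\<nu>)"
proof -
  interpret M: sigma_finite_measure \<mu>
    using haar by (simp add: left_Haar_measure_def)
  interpret N: sigma_finite_measure \<nu> by (rule sigma_finite_\<nu>)
  \<comment> \<open>A density of a sigma-finite measure is again sigma-finite if it is finite almost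
    everywhere; \<open>ennreal (chiG g)\<close> is finite for every \<open>g\<close>.\<close>
  interpret D: sigma_finite_measure "density \<mu> (\<lambda>g. ennreal (chiG g))"
    by (subst M.sigma_finite_iff_density_finite) auto
  interpret pair_sigma_finite "density \<mu> (\<lambda>g. ennreal (chiG g))" \<nu> ..
  have sets: "sets (borel \<Otimes>\<^sub>M restrict_space borel \<Z>) = sets (borel \<Otimes>\<^sub>M \<nu>)"
    by (intro sets_pair_measure_cong) (simp_all add: sets_\<nu>)
  have "\<Phi> \<in> borel_measurable (borel \<Otimes>\<^sub>M restrict_space borel \<Z>)"
    using assms measurable_cong_sets[OF sets refl] by blast
  then have "(\<integral>\<^sup>+ x. \<Phi> (r x, z x) \<partial>restrict_space lam Xs)
      = (\<integral>\<^sup>+ p. \<Phi> p \<partial>(density \<mu> (\<lambda>g. ennreal (chiG g)) \<Otimes>\<^sub>M \<nu>))"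
    unfolding factorization[symmetric]
    by (subst nn_integral_distr[OF decomposition_measurable]) auto
  \<comment> \<open>Tonelli with the group variable innermost: with \<open>y\<close> fixed,
    \<open>s y\<close> is a constant by which \<open>G\<close> can be translated.\<close>
  also have "\<dots> = (\<integral>\<^sup>+ y. (\<integral>\<^sup>+ g. \<Phi> (g, y) \<partial>density \<mu> (\<lambda>g. ennreal (chiG g))) \<partial>\<nu>)"
    by (rule nn_integral_snd[symmetric]) measurable
  also have "\<dots> = (\<integral>\<^sup>+ y. (\<integral>\<^sup>+ g. ennreal (chiG g) * \<Phi> (g, y) \<partial>\<mu>) \<partial>\<nu>)"
  proof (rule nn_integral_cong)
    fix y assume [measurable]: "y \<in> space \<nu>"
    show "(\<integral>\<^sup>+ g. \<Phi> (g, y) \<partial>density \<mu> (\<lambda>g. ennreal (chiG g)))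
        = (\<integral>\<^sup>+ g. ennreal (chiG g) * \<Phi> (g, y) \<partial>\<mu>)"
      by (subst nn_integral_density) measurable
  qed
  finally show ?thesis .
qed

section \<open>The law of \<open>z\<close> at the identity coset\<close>

lemma nn_integral_translates:
  assumes modulus: "right_modulus G \<mu> \<Delta>"
    and [measurable]: "f \<in> borel_measurable borel" and f: "\<And>g. 0 \<le> f g"
  shows "(\<integral>\<^sup>+ x. ennreal (chiG x) * ennreal (f (inv\<^bsub>G\<^esub> g \<otimes>\<^bsub>G\<^esub> x \<otimes>\<^bsub>G\<^esub> t)) \<partial>\<mu>)
    = ennreal (chiG g) * (ennreal (inverse (chiG t * \<Delta> t)) * (\<integral>\<^sup>+ x. ennreal (f x * chiG x) \<partial>\<mu>))"
proof -
  have \<Delta>: "0 < \<Delta> t"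
    using modulus G.carrier_UNIV by (simp add: right_modulus_def)
  \<comment> \<open>Moves the weight to the same argument as \<open>f\<close>; the integrand is then
    a constant times a two-sided translate of the single function \<open>F\<close>.\<close>
  have chi: "chiG x = chiG g * inverse (chiG t) * chiG (inv\<^bsub>G\<^esub> g \<otimes>\<^bsub>G\<^esub> x \<otimes>\<^bsub>G\<^esub> t)" for x
  proof -
    have "chiG g * chiG (inv\<^bsub>G\<^esub> g) = 1"
      using multiplier_one[OF G.group_axioms multiplier_chiG] G.carrier_UNIV
      by (metis G.r_inv UNIV_I chiG_mult)
    then show ?thesis
      using chiG_pos[of t] by (simp add: chiG_mult field_simps)
  qed
  define F where "F x = ennreal (f x * chiG x)" for x
  have [measurable]: "F \<in> borel_measurable borel" unfolding F_def by measurable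
  have "ennreal (chiG x) * ennreal (f (inv\<^bsub>G\<^esub> g \<otimes>\<^bsub>G\<^esub> x \<otimes>\<^bsub>G\<^esub> t))
      = ennreal (chiG g * inverse (chiG t)) * F (inv\<^bsub>G\<^esub> g \<otimes>\<^bsub>G\<^esub> x \<otimes>\<^bsub>G\<^esub> t)" for x
    unfolding F_def using f chiG_pos[THEN less_imp_le]
    by (subst chi) (simp add: ennreal_mult[symmetric] mult_ac)
  then have "(\<integral>\<^sup>+ x. ennreal (chiG x) * ennreal (f (inv\<^bsub>G\<^esub> g \<otimes>\<^bsub>G\<^esub> x \<otimes>\<^bsub>G\<^esub> t)) \<partial>\<mu>)
      = ennreal (chiG g * inverse (chiG t)) * (\<integral>\<^sup>+ x. F (inv\<^bsub>G\<^esub> g \<otimes>\<^bsub>G\<^esub> x \<otimes>\<^bsub>G\<^esub> t) \<partial>\<mu>)"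
    by (simp add: nn_integral_cmult)
  also have "(\<integral>\<^sup>+ x. F (inv\<^bsub>G\<^esub> g \<otimes>\<^bsub>G\<^esub> x \<otimes>\<^bsub>G\<^esub> t) \<partial>\<mu>) = (\<integral>\<^sup>+ x. F (x \<otimes>\<^bsub>G\<^esub> t) \<partial>\<mu>)"
    by (rule G.nn_integral_left_translate[OF haar, of "\<lambda>x. F (x \<otimes>\<^bsub>G\<^esub> t)"]) measurable
  also have "\<dots> = ennreal (inverse (\<Delta> t)) * (\<integral>\<^sup>+ x. F x \<partial>\<mu>)"
    by (rule G.nn_integral_right_translate[OF haar modulus]) measurable
  finally show ?thesis
    using \<Delta> chiG_pos[of g] chiG_pos[of t]
    by (simp add: F_def ennreal_mult mult_ac)
qed

text \<open>Both measures are evaluated on a set \<open>A\<close>. The parameter \<open>g\<close>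
  disappears because the factor \<open>1 / chiG g\<close> of the sampling density cancels the
  \<open>chiG g\<close> produced by the left translation.\<close>

lemma z_distr_one:
  assumes modulus: "right_modulus G \<mu> \<Delta>"
    and [measurable]: "f \<in> borel_measurable borel" and f: "\<And>g. 0 \<le> f g"
  shows "z_distr H G Xs \<Z> actH actG lam chiH chiG r s \<one>\<^bsub>H\<^esub> g f
    = density \<nu> (\<lambda>y. (\<integral>\<^sup>+ x. ennreal (f x * chiG x) \<partial>\<mu>) * ennreal (inverse (chiG (s y) * \<Delta> (s y))))"
    (is "_ = density \<nu> (\<lambda>y. ?C * ?w y)")
proof (rule measure_eqI)
  have [measurable]: "\<Delta> \<in> borel_measurable borel"
    by (rule G.right_modulus_measurable[OF haar modulus])
  let ?p = "sampling_density H G Xs actH actG chiH chiG r s \<one>\<^bsub>H\<^esub> g f"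
  let ?L = "restrict_space lam Xs"
  \<comment> \<open>At the identity of \<open>H\<close> the point \<open>y\<close> in the density is
    \<open>x\<close> itself, so on \<open>Xs\<close> the default value 0 never occurs.\<close>
  have p: "?p x = 1 / chiG g * f (inv\<^bsub>G\<^esub> g \<otimes>\<^bsub>G\<^esub> r x \<otimes>\<^bsub>G\<^esub> s (z x))" if "x \<in> Xs" for x
    using that multiplier_one[OF H.group_axioms multiplier_chiH]
    by (simp add: sampling_density_def actH_one)
  have [measurable]: "s \<in> restrict_space borel \<Z> \<rightarrow>\<^sub>M borel" by (rule measurable_s)
  have [measurable]: "?p \<in> borel_measurable ?L"
    by (subst measurable_cong[OF p]) (auto simp: space_restrict_lam)
  show "sets (z_distr H G Xs \<Z> actH actG lam chiH chiG r s \<one>\<^bsub>H\<^esub> g f)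
      = sets (density \<nu> (\<lambda>y. ?C * ?w y))"
    by (simp add: z_distr_def sets_\<nu>)
  fix A assume "A \<in> sets (z_distr H G Xs \<Z> actH actG lam chiH chiG r s \<one>\<^bsub>H\<^esub> g f)"
  then have A [measurable]: "A \<in> sets (restrict_space borel \<Z>)" by (simp add: z_distr_def)
  then have A\<nu> [measurable]: "A \<in> sets \<nu>" by (simp add: sets_\<nu>)
  \<comment> \<open>The density times the indicator of \<open>z x \<in> A\<close>, expressed in the
    coordinates \<open>(r x, z x)\<close> as the factorization requires.\<close>
  let ?\<Phi> = "\<lambda>(x, y). ennreal (1 / chiG g) * ennreal (f (inv\<^bsub>G\<^esub> g \<otimes>\<^bsub>G\<^esub> x \<otimes>\<^bsub>G\<^esub> s y)) * indicator A y"
  have "emeasure (z_distr H G Xs \<Z> actH actG lam chiH chiG r s \<one>\<^bsub>H\<^esub> g f) A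
      = emeasure (density ?L (\<lambda>x. ennreal (?p x))) (z -` A \<inter> space ?L)"
    unfolding z_distr_def sampling_distr_def by (subst emeasure_distr) auto
  also have "\<dots> = (\<integral>\<^sup>+ x. ennreal (?p x) * indicator (z -` A \<inter> space ?L) x \<partial>?L)"
    by (rule emeasure_density) measurable
  also have "\<dots> = (\<integral>\<^sup>+ x. ?\<Phi> (r x, z x) \<partial>?L)"
    using chiG_pos[of g] f
    by (intro nn_integral_cong)
       (auto simp: p space_restrict_lam ennreal_mult[symmetric] split: split_indicator)
  also have "\<dots> = (\<integral>\<^sup>+ y. (\<integral>\<^sup>+ x. ennreal (chiG x) * ?\<Phi> (x, y) \<partial>\<mu>) \<partial>\<nu>)"
    by (rule nn_integral_factorization) measurable
  also have "\<dots> = (\<integral>\<^sup>+ y. ?C * ?w y * indicator A y \<partial>\<nu>)"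
  proof (rule nn_integral_cong)
    fix y
    have "(\<integral>\<^sup>+ x. ennreal (chiG x) * ?\<Phi> (x, y) \<partial>\<mu>)
        = (\<integral>\<^sup>+ x. ennreal (1 / chiG g) * indicator A y *
            (ennreal (chiG x) * ennreal (f (inv\<^bsub>G\<^esub> g \<otimes>\<^bsub>G\<^esub> x \<otimes>\<^bsub>G\<^esub> s y))) \<partial>\<mu>)"
      by (simp add: mult_ac)
    also have "\<dots> = ennreal (1 / chiG g) * indicator A y * (ennreal (chiG g) * (?w y * ?C))"
      by (subst nn_integral_cmult)
         (auto simp only: nn_integral_translates[OF modulus assms(2) f], measurable)
    also have "\<dots> = ennreal (1 / chiG g * chiG g) * (?C * ?w y * indicator A y)"
      using chiG_pos[of g] by (subst ennreal_mult) (auto simp: mult_ac)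
    finally show "(\<integral>\<^sup>+ x. ennreal (chiG x) * ?\<Phi> (x, y) \<partial>\<mu>) = ?C * ?w y * indicator A y"
      using chiG_pos[of g] by simp
  qed
  also have "\<dots> = emeasure (density \<nu> (\<lambda>y. ?C * ?w y)) A"
    by (rule emeasure_density[symmetric]) measurable
  finally show "emeasure (z_distr H G Xs \<Z> actH actG lam chiH chiG r s \<one>\<^bsub>H\<^esub> g f) A
      = emeasure (density \<nu> (\<lambda>y. ?C * ?w y)) A" .
qed

section \<open>The normalizing constant and the density of \<open>z\<close>\<close>

lemma normalization_constant:
  assumes modulus: "right_modulus G \<mu> \<Delta>"
    and [measurable]: "f \<in> borel_measurable borel" and f: "\<And>g. 0 \<le> f g"
    and norm: "(\<integral>\<^sup>+ x. ennreal (f (r x \<otimes>\<^bsub>G\<^esub> s (z x))) \<partial>restrict_space lam Xs) = 1"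
  shows "(\<integral>\<^sup>+ x. ennreal (f x * chiG x) \<partial>\<mu>) *
    (\<integral>\<^sup>+ y. ennreal (inverse (chiG (s y) * \<Delta> (s y))) \<partial>\<nu>) = 1"
proof -
  have [measurable]: "\<Delta> \<in> borel_measurable borel"
    by (rule G.right_modulus_measurable[OF haar modulus])
  have "1 = (\<integral>\<^sup>+ y. (\<integral>\<^sup>+ x. ennreal (chiG x) * ennreal (f (x \<otimes>\<^bsub>G\<^esub> s y)) \<partial>\<mu>) \<partial>\<nu>)"
    using nn_integral_factorization[of "\<lambda>(x, y). ennreal (f (x \<otimes>\<^bsub>G\<^esub> s y))"] norm by simp
  also have "\<dots> = (\<integral>\<^sup>+ y. ennreal (inverse (chiG (s y) * \<Delta> (s y))) *
      (\<integral>\<^sup>+ x. ennreal (f x * chiG x) \<partial>\<mu>) \<partial>\<nu>)"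
    \<comment> \<open>With the identity for \<open>g\<close>, the left translation is trivial and
      \<open>chiG g\<close> is 1.\<close>
    using nn_integral_translates[OF modulus assms(2) f, of "\<one>\<^bsub>G\<^esub>"]
      multiplier_one[OF G.group_axioms multiplier_chiG] G.carrier_UNIV by simp
  also have "\<dots> = (\<integral>\<^sup>+ y. ennreal (inverse (chiG (s y) * \<Delta> (s y))) \<partial>\<nu>) *
      (\<integral>\<^sup>+ x. ennreal (f x * chiG x) \<partial>\<mu>)"
    by (rule nn_integral_multc) measurable
  finally show ?thesis by (simp add: mult.commute)
qed

text \<open>The identity \<open>?C * ?K = 1\<close> in the extended reals makes both factors finite
  and positive, so they are genuine real integrals. The form \<open>1 / ?k\<close> of the constant
  does not involve \<open>f\<close>.\<close>

lemma z_distr_density: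
  assumes modulus: "right_modulus G \<mu> \<Delta>"
    and h: "h <#\<^bsub>H\<^esub> H0 = \<one>\<^bsub>H\<^esub> <#\<^bsub>H\<^esub> H0"
    and adm: "admissible H G Xs actH actG H0 G0 lam chiH chiG r s f"
  shows "\<exists>c. integrable \<mu> (\<lambda>g. f g * chiG g) \<and> c = (\<integral>g. f g * chiG g \<partial>\<mu>) \<and>
    integrable \<nu> (\<lambda>z. inverse (chiG (s z) * \<Delta> (s z))) \<and>
    c = 1 / (\<integral>z. inverse (chiG (s z) * \<Delta> (s z)) \<partial>\<nu>) \<and> 0 < c \<and>
    z_distr H G Xs \<Z> actH actG lam chiH chiG r s h g f =
    density \<nu> (\<lambda>z. ennreal (c / (chiG (s z) * \<Delta> (s z))))"
proof -
  let ?w = "\<lambda>y. inverse (chiG (s y) * \<Delta> (s y))"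
  let ?C = "\<integral>\<^sup>+ x. ennreal (f x * chiG x) \<partial>\<mu>" and ?K = "\<integral>\<^sup>+ y. ennreal (?w y) \<partial>\<nu>"
  let ?c = "\<integral>g. f g * chiG g \<partial>\<mu>" and ?k = "\<integral>y. ?w y \<partial>\<nu>"
  have [measurable]: "f \<in> borel_measurable borel" and f: "0 \<le> f g" for g
    using adm by (simp_all add: admissible_def)
  have [measurable]: "\<Delta> \<in> borel_measurable borel"
    by (rule G.right_modulus_measurable[OF haar modulus])
  have w: "0 \<le> ?w y" for y
    using chiG_pos[of "s y"] modulus G.carrier_UNIV
    by (simp add: right_modulus_def less_imp_le)
  have CK: "?C * ?K = 1"
    using adm by (intro normalization_constant[OF modulus]) (auto simp: admissible_def)
  \<comment> \<open>\<open>ennreal_mult_eq_1D\<close> bounds only the first factor, hence both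
    orders.\<close>
  then have KC: "?K * ?C = 1" by (simp add: mult.commute)
  have fchi: "0 \<le> f x * chiG x" for x
    using f[of x] chiG_pos[of x] by simp
  have int_f: "integrable \<mu> (\<lambda>g. f g * chiG g)"
    using ennreal_mult_eq_1D(2)[OF CK] fchi by (intro integrableI_nonneg) auto
  have int_w: "integrable \<nu> ?w"
    using ennreal_mult_eq_1D(2)[OF KC] w by (intro integrableI_nonneg) auto
  have C: "?C = ennreal ?c"
    using int_f fchi by (intro nn_integral_eq_integral) auto
  have K: "?K = ennreal ?k"
    using int_w w by (intro nn_integral_eq_integral) auto
  have c0: "0 < ?c" and k0: "0 < ?k"
    \<comment> \<open>The weight must stay one inverse of a product for the equation
      \<open>K\<close> to match.\<close>
    using ennreal_mult_eq_1D(1)[OF CK] ennreal_mult_eq_1D(1)[OF KC] by (simp_all add: C K del: inverse_mult_distrib)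
  have "ennreal (?c * ?k) = ennreal 1"
    using CK c0 k0 by (simp add: C K ennreal_mult del: inverse_mult_distrib)
  then have "?c * ?k = 1"
    using c0 k0 by (subst (asm) ennreal_inj) auto
  then have ck: "?c = 1 / ?k"
    using k0 by (simp add: field_simps)
  have "z_distr H G Xs \<Z> actH actG lam chiH chiG r s h g f
      = z_distr H G Xs \<Z> actH actG lam chiH chiG r s \<one>\<^bsub>H\<^esub> g f"
  proof -
    have "sampling_distr H G Xs actH actG lam chiH chiG r s h g f
        = sampling_distr H G Xs actH actG lam chiH chiG r s \<one>\<^bsub>H\<^esub> g f"
      \<comment> \<open>The identifiability equivalence read from right to left, with
        \<open>g' = g\<close>.\<close>
      using adm h unfolding admissible_def by blast
    then show ?thesis by (simp add: z_distr_def)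
  qed
  also have "\<dots> = density \<nu> (\<lambda>y. ?C * ennreal (?w y))"
    using f by (intro z_distr_one[OF modulus]) auto
  also have "(\<lambda>y. ?C * ennreal (?w y)) = (\<lambda>y. ennreal (?c / (chiG (s y) * \<Delta> (s y))))"
    unfolding C using c0 w by (simp add: ennreal_mult[symmetric] divide_inverse del: inverse_mult_distrib)
  finally show ?thesis using int_f int_w ck c0 by blast
qed

end

theorem theorem3p1:
  fixes H :: "'h :: {t2_space, second_countable_topology} monoid"
    and G :: "'g :: {t2_space, second_countable_topology} monoid"
    and Xs \<Z> :: "'x :: t2_space set"
    and \<Delta> :: "'g \<Rightarrow> real"
  assumes model: "orbital_model H G Xs \<Z> actH actG H0 G0 lam \<mu> \<nu> chiH chiG r s"
    and modulus: "right_modulus G \<mu> \<Delta>"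
  shows "(\<forall>h g. h <#\<^bsub>H\<^esub> H0 = \<one>\<^bsub>H\<^esub> <#\<^bsub>H\<^esub> H0 \<longrightarrow>
      (\<forall>f f'. admissible H G Xs actH actG H0 G0 lam chiH chiG r s f \<longrightarrow>
              admissible H G Xs actH actG H0 G0 lam chiH chiG r s f' \<longrightarrow>
         z_distr H G Xs \<Z> actH actG lam chiH chiG r s h g f =
         z_distr H G Xs \<Z> actH actG lam chiH chiG r s h g f')) \<and>
    (\<forall>h g f. h <#\<^bsub>H\<^esub> H0 = \<one>\<^bsub>H\<^esub> <#\<^bsub>H\<^esub> H0 \<longrightarrow>
      admissible H G Xs actH actG H0 G0 lam chiH chiG r s f \<longrightarrow>
      (\<exists>c. integrable \<mu> (\<lambda>g. f g * chiG g) \<and> c = (\<integral>g. f g * chiG g \<partial>\<mu>) \<and>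
           integrable \<nu> (\<lambda>z. inverse (chiG (s z) * \<Delta> (s z))) \<and>
           c = 1 / (\<integral>z. inverse (chiG (s z) * \<Delta> (s z)) \<partial>\<nu>) \<and> 0 < c \<and>
           z_distr H G Xs \<Z> actH actG lam chiH chiG r s h g f =
           density \<nu> (\<lambda>z. ennreal (c / (chiG (s z) * \<Delta> (s z))))))"
proof -
  interpret orbital_model H G Xs \<Z> actH actG H0 G0 lam \<mu> \<nu> chiH chiG r s by (rule model)
  show ?thesis
  proof (intro conjI allI impI)
    fix h g f f'
    assume "h <#\<^bsub>H\<^esub> H0 = \<one>\<^bsub>H\<^esub> <#\<^bsub>H\<^esub> H0"
      and "admissible H G Xs actH actG H0 G0 lam chiH chiG r s f"
      and "admissible H G Xs actH actG H0 G0 lam chiH chiG r s f'"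
    \<comment> \<open>For \<open>f\<close> and for \<open>f'\<close> the constant is the same
      reciprocal of an integral over \<open>\<nu>\<close>, so the two densities coincide.\<close>
    then show "z_distr H G Xs \<Z> actH actG lam chiH chiG r s h g f =
        z_distr H G Xs \<Z> actH actG lam chiH chiG r s h g f'"
      using z_distr_density[OF modulus, of h f g] z_distr_density[OF modulus, of h f' g] by metis
  qed (rule z_distr_density[OF modulus])
qed

end
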